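(* Let $q=\dfrac{a^4+b^4+c^4}{(a^2+b^2+c^2)^2}$ be the quadrofactor of a plane triangle with side lengths $a,b,c$, and let $\sqrt{3-6q}$ be its normalized area. Then 1. $\sqrt{3-6q}\le1$; 2. $\sqrt{3-6q}=1$ if and only if the triangle is regular; 3. $\sqrt{3-6q}=0$ if and only if the triangle is linear.
   Context: A plane triangle is a triple $(z_1,z_2,z_3)$ of points of $\mathbb C$ that is non-singular, i.e. not $z_1=z_2=z_3$; its sides are $a=|z_1-z_2|$, $b=|z_2-z_3|$, $c=|z_3-z_1|$. Its normalized area is $\frac{4\sqrt3A}{a^2+b^2+c^2}$, where $A$ is its area; this number equals $\sqrt{3-6q}$. A triangle is equilateral if $a=b=c$; regular if it is equilateral and not singular; linear if there are pairwise distinct $i,j,k\in\{1,2,3\}$ with $|z_i-z_k|=|z_i-z_j|+|z_j-z_k|$. *)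

theory Defs
  imports "HOL-Analysis.Analysis"
begin

text \<open>
  A triple of points of the plane is a vector \<open>z :: complex^3\<close>; the three indices of the type
  \<open>3\<close> are \<open>1, 2, 3\<close> (as \<open>3 = 0\<close> there, these are pairwise distinct and exhaust the type).
\<close>

definition singular :: "complex^3 \<Rightarrow> bool" where
  "singular z \<longleftrightarrow> z$1 = z$2 \<and> z$2 = z$3"

definition plane_triangle :: "complex^3 \<Rightarrow> bool" where
  "plane_triangle z \<longleftrightarrow> \<not> singular z"

definition side_a :: "complex^3 \<Rightarrow> real" where
  "side_a z = norm (z$1 - z$2)"

definition side_b :: "complex^3 \<Rightarrow> real" where
  "side_b z = norm (z$2 - z$3)"

definition side_c :: "complex^3 \<Rightarrow> real" where
  "side_c z = norm (z$3 - z$1)"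

definition equilateral :: "complex^3 \<Rightarrow> bool" where
  "equilateral z \<longleftrightarrow> side_a z = side_b z \<and> side_b z = side_c z"

definition regular_triangle :: "complex^3 \<Rightarrow> bool" where
  "regular_triangle z \<longleftrightarrow> equilateral z \<and> \<not> singular z"

definition linear_triangle :: "complex^3 \<Rightarrow> bool" where
  "linear_triangle z \<longleftrightarrow>
     (\<exists>i j k. i \<noteq> j \<and> j \<noteq> k \<and> i \<noteq> k \<and>
        norm (z$i - z$k) = norm (z$i - z$j) + norm (z$j - z$k))"

definition quadrofactor :: "complex^3 \<Rightarrow> real" where
  "quadrofactor z =
     (side_a z ^ 4 + side_b z ^ 4 + side_c z ^ 4) /
     (side_a z ^ 2 + side_b z ^ 2 + side_c z ^ 2) ^ 2"

definition triangle_area :: "complex^3 \<Rightarrow> real" where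
  "triangle_area z = measure lborel (convex hull {z$1, z$2, z$3})"

definition normalized_area :: "complex^3 \<Rightarrow> real" where
  "normalized_area z =
     4 * sqrt 3 * triangle_area z / (side_a z ^ 2 + side_b z ^ 2 + side_c z ^ 2)"

subsection \<open>The normalized area in terms of the quadrofactor\<close>

text \<open>
  The library computes areas of triangles in \<open>real^2\<close>; the identification of \<open>complex\<close> with
  \<open>real^2\<close> preserves Lebesgue measure.
\<close>

definition complex_of_vec :: "real^2 \<Rightarrow> complex" where
  "complex_of_vec x = Complex (x$1) (x$2)"

lemma linear_complex_of_vec: "linear complex_of_vec"
  by (rule linearI) (simp_all add: complex_of_vec_def complex_eq_iff)

lemma inj_complex_of_vec: "inj complex_of_vec"
  by (auto simp: inj_def complex_of_vec_def vec_eq_iff forall_2)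

lemma complex_of_vec_vector: "complex_of_vec (vector [Re w, Im w]) = w"
  by (simp add: complex_of_vec_def)

lemma measurable_complex_of_vec: "complex_of_vec \<in> borel_measurable lborel"
  using linear_continuous_on[OF linear_complex_of_vec[THEN linear_conv_bounded_linear[THEN iffD1]]]
  by (simp add: borel_measurable_continuous_onI)

lemma lborel_complex: "(lborel :: complex measure) = distr lborel borel complex_of_vec"
proof (rule lborel_eqI)
  fix l u :: complex
  assume le: "\<And>b. b \<in> Basis \<Longrightarrow> l \<bullet> b \<le> u \<bullet> b"
  have le': "Re l \<le> Re u" "Im l \<le> Im u"
    using le[of 1] le[of \<i>] by (auto simp: Basis_complex_def)
  have Basis2: "(Basis :: (real^2) set) = {axis 1 1, axis 2 1}"
    by (auto simp: Basis_vec_def) (metis exhaust_2)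
  have ne: "axis 1 1 \<noteq> (axis 2 1 :: real^2)" by (simp add: axis_eq_axis)
  have vim: "complex_of_vec -` box l u =
               box (vector [Re l, Im l]) (vector [Re u, Im u])"
    by (auto simp: complex_of_vec_def mem_box Basis_complex_def Basis2 inner_axis)
  show "emeasure (distr lborel borel complex_of_vec) (box l u) =
          ennreal (\<Prod>b\<in>Basis. (u - l) \<bullet> b)"
    using le' ne measurable_complex_of_vec
    by (subst emeasure_distr)
       (auto simp: vim emeasure_lborel_box_eq Basis2 inner_axis Basis_complex_def complex_eq_iff)
qed simp

lemma triangle_area_heron:
  "16 * triangle_area z ^ 2 =
     (side_a z ^ 2 + side_b z ^ 2 + side_c z ^ 2) ^ 2 -
     2 * (side_a z ^ 4 + side_b z ^ 4 + side_c z ^ 4)"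
proof -
  define v :: "complex \<Rightarrow> real^2" where "v w = vector [Re w, Im w]" for w
  define S where "S = convex hull {v (z$1), v (z$2), v (z$3)}"
  have "complex_of_vec ` S = convex hull (complex_of_vec ` {v (z$1), v (z$2), v (z$3)})"
    unfolding S_def by (rule convex_hull_linear_image[OF linear_complex_of_vec])
  then have im: "convex hull {z$1, z$2, z$3} = complex_of_vec ` S"
    by (simp add: v_def complex_of_vec_vector)
  have "compact (convex hull {z$1, z$2, z$3})"
    by (intro finite_imp_compact_convex_hull) auto
  then have "convex hull {z$1, z$2, z$3} \<in> sets borel"
    by (simp add: compact_imp_closed)
  then have area: "triangle_area z = measure lborel S"
    using measurable_complex_of_vec
    unfolding triangle_area_def lborel_complex
    by (subst measure_distr) (auto simp: im inj_vimage_image_eq[OF inj_complex_of_vec])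
  have sq: "side_a z ^ 2 = (Re (z$1) - Re (z$2))^2 + (Im (z$1) - Im (z$2))^2"
           "side_b z ^ 2 = (Re (z$2) - Re (z$3))^2 + (Im (z$2) - Im (z$3))^2"
           "side_c z ^ 2 = (Re (z$3) - Re (z$1))^2 + (Im (z$3) - Im (z$1))^2"
    by (simp_all add: side_a_def side_b_def side_c_def cmod_power2)
  have pow4: "x ^ 4 = (x ^ 2) ^ 2" for x :: real by simp
  have "16 * triangle_area z ^ 2 =
          4 * ((Re (z$3) - Re (z$1)) * (Im (z$2) - Im (z$1)) -
               (Re (z$2) - Re (z$1)) * (Im (z$3) - Im (z$1)))^2"
    unfolding area S_def by (subst content_triangle) (simp add: v_def power_divide)
  also have "\<dots> = (side_a z ^ 2 + side_b z ^ 2 + side_c z ^ 2) ^ 2 -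
                   2 * (side_a z ^ 4 + side_b z ^ 4 + side_c z ^ 4)"
    unfolding pow4 sq unfolding power2_eq_square by algebra
  finally show ?thesis .
qed

lemma normalized_area_eq:
  assumes "plane_triangle z"
  shows "normalized_area z = sqrt (3 - 6 * quadrofactor z)"
proof -
  define s where "s = side_a z ^ 2 + side_b z ^ 2 + side_c z ^ 2"
  define p where "p = side_a z ^ 4 + side_b z ^ 4 + side_c z ^ 4"
  have "side_a z \<noteq> 0 \<or> side_b z \<noteq> 0"
    using assms by (auto simp: plane_triangle_def singular_def side_a_def side_b_def)
  then have "s > 0"
    unfolding s_def
    by (metis add_pos_nonneg add_nonneg_pos zero_le_power2 zero_less_power2)
  have heron: "16 * triangle_area z ^ 2 = s^2 - 2 * p"
    using triangle_area_heron[of z] by (simp add: s_def p_def)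
  have "normalized_area z ^ 2 = 3 * (16 * triangle_area z ^ 2) / s^2"
    by (simp add: normalized_area_def s_def[symmetric] power_divide power_mult_distrib)
  also have "\<dots> = 3 - 6 * quadrofactor z"
    unfolding heron quadrofactor_def s_def[symmetric] p_def[symmetric]
    using \<open>s > 0\<close> by (simp add: field_simps)
  finally have "normalized_area z ^ 2 = 3 - 6 * quadrofactor z" .
  moreover have "normalized_area z \<ge> 0"
    using \<open>s > 0\<close> by (simp add: normalized_area_def s_def[symmetric] triangle_area_def)
  ultimately show ?thesis
    by (metis real_sqrt_unique)
qed

text \<open>In particular the radicand is nonnegative, so \<open>sqrt\<close> is applied within its usual domain.\<close>

lemma radicand_nonneg:
  assumes "plane_triangle z"
  shows "0 \<le> 3 - 6 * quadrofactor z"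
proof -
  have "normalized_area z \<ge> 0"
    by (simp add: normalized_area_def triangle_area_def)
  then show ?thesis
    by (simp only: normalized_area_eq[OF assms] real_sqrt_ge_0_iff)
qed

end

theory Submission
  imports Defs
begin

text \<open>
  Put \<open>s = a\<^sup>2 + b\<^sup>2 + c\<^sup>2\<close> and \<open>p = a\<^sup>4 + b\<^sup>4 + c\<^sup>4\<close>, so that \<open>q = p / s\<^sup>2\<close>, where
  \<open>s > 0\<close> because the three points do not coincide. Both ends of the range of the normalized
  area come from an algebraic identity in the side lengths.

  The upper end \<open>3 - 6 q \<le> 1\<close> amounts to \<open>s\<^sup>2 \<le> 3 p\<close>, the Cauchy-Schwarz inequality for the
  squared sides. Its defect \<open>3 p - s\<^sup>2\<close> is the sum of the squares of their pairwise differences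
  (\<open>sum_of_squares_defect\<close>), so equality means \<open>a = b = c\<close>.

  The lower end \<open>3 - 6 q = 0\<close> amounts to \<open>s\<^sup>2 = 2 p\<close>. By Heron's factorization
  (\<open>heron_factorization\<close>), \<open>s\<^sup>2 - 2 p\<close> is the product of the perimeter, which is
  positive, and the three excesses \<open>a + b - c\<close>, \<open>b + c - a\<close>, \<open>c + a - b\<close>. It vanishes exactly
  when one side is the sum of the other two.
\<close>

lemma sum_of_squares_defect:
  fixes x y z :: "'a::comm_ring_1"
  shows "3 * (x^2 + y^2 + z^2) - (x + y + z)^2 = (x - y)^2 + (y - z)^2 + (z - x)^2"
  by (simp add: power2_eq_square algebra_simps)

lemma heron_factorization:
  fixes a b c :: "'a::comm_ring_1"
  shows "(a^2 + b^2 + c^2)^2 - 2 * (a^4 + b^4 + c^4) =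
           (a + b + c) * (a + b - c) * (b + c - a) * (c + a - b)"
  by (simp add: power2_eq_square power4_eq_xxxx algebra_simps)

lemma sum_squares_sides_pos:
  assumes "plane_triangle z"
  shows "side_a z ^ 2 + side_b z ^ 2 + side_c z ^ 2 > 0"
proof -
  have "side_a z \<noteq> 0 \<or> side_b z \<noteq> 0"
    using assms by (auto simp: plane_triangle_def singular_def side_a_def side_b_def)
  then show ?thesis
    by (metis add_pos_nonneg add_nonneg_pos zero_le_power2 zero_less_power2)
qed

text \<open>
  The six orderings of the vertices give three different conditions, because reversing
  \<open>i, j, k\<close> changes nothing: the vertex \<open>j\<close> in the middle determines which side is the longest.
\<close>

lemma linear_triangle_iff_sides:
  "linear_triangle z \<longleftrightarrow>
     side_c z = side_a z + side_b z \<or> side_a z = side_b z + side_c z \<or>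
     side_b z = side_c z + side_a z"
  (is "_ \<longleftrightarrow> ?R")
proof
  have ne: "(1::3) \<noteq> 2" "(2::3) \<noteq> 3" "(1::3) \<noteq> 3"
    by simp_all
  have sym: "norm (z$2 - z$1) = side_a z" "norm (z$3 - z$2) = side_b z"
            "norm (z$1 - z$3) = side_c z"
            "norm (z$1 - z$2) = side_a z" "norm (z$2 - z$3) = side_b z"
            "norm (z$3 - z$1) = side_c z"
    by (simp_all add: side_a_def side_b_def side_c_def norm_minus_commute)
  show ?R if linear: "linear_triangle z"
  proof -
    obtain i j k where distinct: "i \<noteq> j" "j \<noteq> k" "i \<noteq> k"
      and eq: "norm (z$i - z$k) = norm (z$i - z$j) + norm (z$j - z$k)"
      using linear by (auto simp: linear_triangle_def)
    show ?R
      using exhaust_3[of i] exhaust_3[of j] exhaust_3[of k] distinct eq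
      by (elim disjE) (simp_all add: sym)
  qed
  have lin: "linear_triangle z"
    if "i \<noteq> j" "j \<noteq> k" "i \<noteq> k" "norm (z$i - z$k) = norm (z$i - z$j) + norm (z$j - z$k)"
    for i j k
    using that by (auto simp: linear_triangle_def)
  show "linear_triangle z" if ?R
    using that lin[of 1 2 3] lin[of 2 3 1] lin[of 3 1 2] ne by (auto simp: sym)
qed

theorem corollary1:
  fixes z :: "complex^3" and q :: real
  assumes "plane_triangle z"
    and "q = quadrofactor z"
  shows "sqrt (3 - 6 * q) \<le> 1 \<and>
         (sqrt (3 - 6 * q) = 1 \<longleftrightarrow> regular_triangle z) \<and>
         (sqrt (3 - 6 * q) = 0 \<longleftrightarrow> linear_triangle z)"
proof -
  define a b c where "a = side_a z" and "b = side_b z" and "c = side_c z"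
  define s p where "s = a^2 + b^2 + c^2" and "p = a^4 + b^4 + c^4"
  have nonneg: "a \<ge> 0" "b \<ge> 0" "c \<ge> 0"
    by (simp_all add: a_def b_def c_def side_a_def side_b_def side_c_def)
  have "s > 0"
    using sum_squares_sides_pos[OF assms(1)] by (simp add: s_def a_def b_def c_def)
  have q: "q = p / s^2"
    by (simp add: assms(2) quadrofactor_def s_def p_def a_def b_def c_def)
  have defect: "3 * p - s^2 = (a^2 - b^2)^2 + (b^2 - c^2)^2 + (c^2 - a^2)^2"
    using sum_of_squares_defect[of "a^2" "b^2" "c^2"] by (simp add: s_def p_def)
  have le: "sqrt (3 - 6 * q) \<le> 1"
  proof -
    have "s^2 \<le> 3 * p"
      using defect by (smt (verit) zero_le_power2)
    then show ?thesis
      using \<open>s > 0\<close> by (simp add: q field_simps)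
  qed
  have "sqrt (3 - 6 * q) = 1 \<longleftrightarrow> 3 * p - s^2 = 0"
    using \<open>s > 0\<close> by (auto simp: q field_simps)
  also have "\<dots> \<longleftrightarrow> a^2 = b^2 \<and> b^2 = c^2"
    unfolding defect by (auto simp: add_nonneg_eq_0_iff)
  also have "\<dots> \<longleftrightarrow> regular_triangle z"
    using nonneg assms(1)
    by (simp add: regular_triangle_def equilateral_def plane_triangle_def a_def b_def c_def)
  finally have one: "sqrt (3 - 6 * q) = 1 \<longleftrightarrow> regular_triangle z" .
  have "a + b + c \<noteq> 0"
    using nonneg \<open>s > 0\<close> by (auto simp: s_def add_nonneg_eq_0_iff)
  have "sqrt (3 - 6 * q) = 0 \<longleftrightarrow> s^2 - 2 * p = 0"
    using \<open>s > 0\<close> by (auto simp: q field_simps)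
  also have "\<dots> \<longleftrightarrow> c = a + b \<or> a = b + c \<or> b = c + a"
    unfolding s_def p_def heron_factorization using \<open>a + b + c \<noteq> 0\<close> by auto
  also have "\<dots> \<longleftrightarrow> linear_triangle z"
    by (simp add: linear_triangle_iff_sides a_def b_def c_def)
  finally show ?thesis
    using le one by blast
qed

end
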